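(* Let $R$ be a $3$-row graph such that $R_C$ is eulerian. Then $R$ has an amiable coloring if $R[V_i]$ is connected for some $i\in\{1,2,3\}$.
   Context: All graphs are finite and loopless; parallel edges are allowed. A graph (not necessarily connected) is eulerian if every vertex has even degree. $E_v$ is the set of edges incident with $v$; given an edge-coloring, $d_c(v,R)$ is the number of edges of color $c$ of $R$ incident with $v$. Colorings need not be proper; $3$-colorings use the colors $1,2,3$. A $3$-row graph $R$ is a graph with vertices $v_{ij}$, $1\le i\le 3$, $1\le j\le s$, such that each column $C_j:=\{v_{1j},v_{2j},v_{3j}\}$ is an independent set of $R$. $V_i:=\{v_{ij}:1\le j\le s\}$ is the vertex set of the $i$-th row. $R_C$ is the graph with vertex set $\{c_1,\dots,c_s\}$ obtained from $R$ by identifying, for each $j$, all vertices of $C_j$ to the single vertex $c_j$ (parallel edges are kept). An amiable coloring of a $3$-row graph $R$ is a $3$-vertex-coloring $f$ together with a $3$-edge-coloring $g$ such that for all $i\in\{1,2,3\}$ and $j\in\{1,\dots,s\}$: (i) $f(v)\ne f(w)$ for all $v\neq w$ in $C_j$; (ii) $f(v)\neq g(e)$ for every $v\in V(R)$ and every $e\in E_v$; (iii) $d_i(v_{1j},R)+d_i(v_{2j},R)+d_i(v_{3j},R)$ is even. *)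

theory Defs
  imports Main
begin

section \<open>Finite loopless multigraphs\<close>

text \<open>Edges are abstract objects, so that parallel edges are distinct edges with the same ends.\<close>

record ('v, 'e) multigraph =
  verts :: "'v set"
  edges :: "'e set"
  ends :: "'e \<Rightarrow> 'v set"

definition loopless_multigraph :: "('v, 'e) multigraph \<Rightarrow> bool" where
  "loopless_multigraph G \<longleftrightarrow>
     finite (verts G) \<and> finite (edges G) \<and>
     (\<forall>e\<in>edges G. ends G e \<subseteq> verts G \<and> card (ends G e) = 2)"

definition incident_edges :: "('v, 'e) multigraph \<Rightarrow> 'v \<Rightarrow> 'e set" where
  "incident_edges G x = {e \<in> edges G. x \<in> ends G e}"

text \<open>Counting incident edges gives the degree because all graphs are loopless.\<close>

definition degree :: "('v, 'e) multigraph \<Rightarrow> 'v \<Rightarrow> nat" where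
  "degree G x = card (incident_edges G x)"

definition color_degree :: "('v, 'e) multigraph \<Rightarrow> ('e \<Rightarrow> nat) \<Rightarrow> nat \<Rightarrow> 'v \<Rightarrow> nat" where
  "color_degree G g c x = card {e \<in> incident_edges G x. g e = c}"

text \<open>An eulerian graph need not be connected.\<close>

definition eulerian :: "('v, 'e) multigraph \<Rightarrow> bool" where
  "eulerian G \<longleftrightarrow> (\<forall>x\<in>verts G. even (degree G x))"

definition independent_set :: "('v, 'e) multigraph \<Rightarrow> 'v set \<Rightarrow> bool" where
  "independent_set G W \<longleftrightarrow> W \<subseteq> verts G \<and> \<not> (\<exists>e\<in>edges G. ends G e \<subseteq> W)"

definition induced_subgraph :: "('v, 'e) multigraph \<Rightarrow> 'v set \<Rightarrow> ('v, 'e) multigraph" where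
  "induced_subgraph G W =
     \<lparr>verts = verts G \<inter> W, edges = {e \<in> edges G. ends G e \<subseteq> W}, ends = ends G\<rparr>"

definition adjacency :: "('v, 'e) multigraph \<Rightarrow> 'v rel" where
  "adjacency G = {(x, y). \<exists>e\<in>edges G. ends G e = {x, y}}"

definition connected_graph :: "('v, 'e) multigraph \<Rightarrow> bool" where
  "connected_graph G \<longleftrightarrow> (\<forall>x\<in>verts G. \<forall>y\<in>verts G. (x, y) \<in> (adjacency G)\<^sup>*)"


section \<open>3-row graphs\<close>

text \<open>The vertex in row \<open>i\<close> and column \<open>j\<close> is \<open>v i j\<close>, for \<open>1 \<le> i \<le> 3\<close> and \<open>1 \<le> j \<le> s\<close>;
  other values of \<open>v\<close> are irrelevant.\<close>

definition row :: "(nat \<Rightarrow> nat \<Rightarrow> 'v) \<Rightarrow> nat \<Rightarrow> nat \<Rightarrow> 'v set" where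
  "row v s i = {v i j | j. j \<in> {1..s}}"

definition column :: "(nat \<Rightarrow> nat \<Rightarrow> 'v) \<Rightarrow> nat \<Rightarrow> 'v set" where
  "column v j = {v 1 j, v 2 j, v 3 j}"

definition three_row_graph :: "('v, 'e) multigraph \<Rightarrow> (nat \<Rightarrow> nat \<Rightarrow> 'v) \<Rightarrow> nat \<Rightarrow> bool" where
  "three_row_graph R v s \<longleftrightarrow>
     loopless_multigraph R \<and>
     bij_betw (\<lambda>(i, j). v i j) ({1..3} \<times> {1..s}) (verts R) \<and>
     (\<forall>j\<in>{1..s}. independent_set R (column v j))"

text \<open>The graph \<open>R\<^sub>C\<close>, whose vertex \<open>c\<^sub>j\<close> is represented by the index \<open>j\<close>. It has the same
  edges as \<open>R\<close>, each end being replaced by the index of its column. Since columns are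
  independent sets, no loop arises.\<close>

definition column_graph ::
    "('v, 'e) multigraph \<Rightarrow> (nat \<Rightarrow> nat \<Rightarrow> 'v) \<Rightarrow> nat \<Rightarrow> (nat, 'e) multigraph" where
  "column_graph R v s =
     \<lparr>verts = {1..s}, edges = edges R,
      ends = (\<lambda>e. {j \<in> {1..s}. ends R e \<inter> column v j \<noteq> {}})\<rparr>"

definition amiable_coloring ::
    "('v, 'e) multigraph \<Rightarrow> (nat \<Rightarrow> nat \<Rightarrow> 'v) \<Rightarrow> nat \<Rightarrow> ('v \<Rightarrow> nat) \<Rightarrow> ('e \<Rightarrow> nat) \<Rightarrow> bool" where
  "amiable_coloring R v s f g \<longleftrightarrow>
     (\<forall>x\<in>verts R. f x \<in> {1, 2, 3}) \<and>
     (\<forall>e\<in>edges R. g e \<in> {1, 2, 3}) \<and>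
     (\<forall>j\<in>{1..s}. \<forall>x\<in>column v j. \<forall>y\<in>column v j. x \<noteq> y \<longrightarrow> f x \<noteq> f y) \<and>
     (\<forall>x\<in>verts R. \<forall>e\<in>incident_edges R x. f x \<noteq> g e) \<and>
     (\<forall>i\<in>{1, 2, 3}. \<forall>j\<in>{1..s}.
        even (color_degree R g i (v 1 j) + color_degree R g i (v 2 j) + color_degree R g i (v 3 j)))"

end

theory Submission
  imports Defs
begin

text \<open>
  Give every vertex of the connected row color 1, and in each column give the other two vertices
  the colors 2 and 3 in one of the two possible orders. Since the two ends of an edge exclude
  their colors, an edge has no choice when its ends have different colors, and has two
  admissible colors when its ends have the same color. The edges are thus of three kinds.

  An edge avoiding the connected row may always have color 1, and it has a second admissible
  color exactly if its ends agree. Let \<open>H\<close> be the set of these edges. Whether the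
  ends of an edge of \<open>H\<close> agree depends only on the orders chosen in its two columns,
  so \<open>H\<close> is a signed graph on the columns and choosing the orders amounts to
  switching signs. The lemma \<open>switching\<close> says that some choice of orders keeps all
  connections between columns within the edges with agreeing ends. By \<open>parity_join\<close>
  there is then a set \<open>A\<close> of edges with agreeing ends that has the same degree
  parities as \<open>H\<close>. Exactly the edges of \<open>H - A\<close> get color 1, which
  settles the parity of that color in every column.

  An edge with exactly one end in the connected row has the forced color 2 or 3.

  An edge inside the connected row may have color 2 or 3 freely. Because that row is connected,
  its edges join all columns, and \<open>parity_join\<close> supplies a subset \<open>J\<close>
  of them whose degree parities are those of the set of all other edges of color 2. Giving
  color 2 to \<open>J\<close> and color 3 to the rest of the row settles color 2. Color 3
  then follows from the total degree being even.
\<close>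

section \<open>Degree parities of edge sets\<close>

text \<open>In this section and the next one an edge \<open>e\<close> is known only through the set
  \<open>E e\<close> of its ends, because the results are applied to the edges of a 3-row graph
  with the columns as ends.\<close>

definition odd_at :: "('e \<Rightarrow> 'c set) \<Rightarrow> 'e set \<Rightarrow> 'c \<Rightarrow> bool" where
  "odd_at E P c \<longleftrightarrow> odd (card {e \<in> P. c \<in> E e})"

definition links :: "('e \<Rightarrow> 'c set) \<Rightarrow> 'e set \<Rightarrow> 'c rel" where
  "links E M = {(a, b). \<exists>e\<in>M. E e = {a, b}}"

lemma odd_at_empty [simp]: "\<not> odd_at E {} c"
  by (simp add: odd_at_def)

lemma odd_at_singleton [simp]: "odd_at E {e} c \<longleftrightarrow> c \<in> E e"
proof -
  have "{e' \<in> {e}. c \<in> E e'} = (if c \<in> E e then {e} else {})"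
    by auto
  then show ?thesis
    by (simp add: odd_at_def)
qed

lemma odd_at_sym_diff:
  assumes "finite P" "finite Q"
  shows "odd_at E (sym_diff P Q) c \<longleftrightarrow> odd_at E P c \<noteq> odd_at E Q c"
proof -
  let ?X = "{e \<in> P. c \<in> E e}" and ?Y = "{e \<in> Q. c \<in> E e}"
  have fin: "finite ?X" "finite ?Y"
    using assms by auto
  have "{e \<in> sym_diff P Q. c \<in> E e} = (?X - ?Y) \<union> (?Y - ?X)"
    by auto
  moreover have "card ((?X - ?Y) \<union> (?Y - ?X)) = card (?X - ?Y) + card (?Y - ?X)"
    using fin by (intro card_Un_disjoint) auto
  moreover have "card ?X = card (?X - ?Y) + card (?X \<inter> ?Y)"
    using card_Int_Diff[OF fin(1), of ?Y] by simp
  moreover have "card ?Y = card (?Y - ?X) + card (?X \<inter> ?Y)"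
    using card_Int_Diff[OF fin(2), of ?X] by (simp add: Int_commute)
  ultimately show ?thesis
    unfolding odd_at_def by auto
qed

lemma sym_links: "sym (links E M)"
  by (auto simp: links_def sym_def insert_commute)

text \<open>The edges of a walk, counted modulo 2, have odd degree exactly at the two ends of the
  walk. Adding edges by symmetric difference makes it unnecessary for the walk to be a
  path.\<close>

lemma path_join:
  assumes "(j, k) \<in> (links E M)\<^sup>*" "finite M" "\<forall>e\<in>M. card (E e) = 2"
  shows "\<exists>P\<subseteq>M. \<forall>c. odd_at E P c \<longleftrightarrow> (c = j) \<noteq> (c = k)"
  using assms(1)
proof (induction rule: rtrancl_induct)
  case base
  show ?case
    by (rule exI[of _ "{}"]) auto
next
  case (step y z)
  then obtain P where P: "P \<subseteq> M" "\<forall>c. odd_at E P c \<longleftrightarrow> (c = j) \<noteq> (c = y)"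
    by blast
  obtain e where e: "e \<in> M" "E e = {y, z}"
    using step.hyps by (auto simp: links_def)
  have "y \<noteq> z"
    using e assms(3) by force
  have "finite P"
    using P assms(2) finite_subset by blast
  then have "\<forall>c. odd_at E (sym_diff P {e}) c \<longleftrightarrow> (c = j) \<noteq> (c = z)"
    using P e \<open>y \<noteq> z\<close> by (subst odd_at_sym_diff) auto
  then show ?case
    using P e by (intro exI[of _ "sym_diff P {e}"]) auto
qed

text \<open>Replace each edge of \<open>B\<close> by a walk in \<open>M\<close> between its
  ends and add up these walks modulo 2. This is the existence of \<open>T\<close>-joins, with
  \<open>T\<close> presented as the set of odd vertices of \<open>B\<close>; that way no condition
  on the parity of \<open>card T\<close> in the components of \<open>M\<close> has to be
  stated.\<close>

lemma parity_join:
  assumes "finite B" "finite M" "\<forall>e\<in>M. card (E e) = 2" "\<forall>e\<in>B. card (E e) = 2"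
    and "\<forall>e\<in>B. \<forall>j\<in>E e. \<forall>k\<in>E e. (j, k) \<in> (links E M)\<^sup>*"
  shows "\<exists>J\<subseteq>M. \<forall>c. odd_at E J c = odd_at E B c"
  using assms(1,4,5)
proof (induction rule: finite_induct)
  case empty
  then show ?case
    by blast
next
  case (insert e B)
  then obtain J where J: "J \<subseteq> M" "\<forall>c. odd_at E J c = odd_at E B c"
    by auto
  obtain j k where jk: "E e = {j, k}" "j \<noteq> k"
    using insert.prems(1) by (metis card_2_iff insertI1)
  then obtain P where P: "P \<subseteq> M" "\<forall>c. odd_at E P c \<longleftrightarrow> (c = j) \<noteq> (c = k)"
    using path_join[of j k E M] insert.prems(2) assms by auto
  have fin: "finite J" "finite P"
    using J P assms(2) finite_subset by blast+
  have "insert e B = sym_diff B {e}"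
    using insert.hyps by auto
  then have "\<forall>c. odd_at E (sym_diff J P) c = odd_at E (insert e B) c"
    using J P jk fin insert.hyps odd_at_sym_diff[of J P E] odd_at_sym_diff[of B "{e}" E] by auto
  then show ?case
    using J P by (intro exI[of _ "sym_diff J P"]) auto
qed

section \<open>Switching a signed graph\<close>

text \<open>The map \<open>b\<close> is a signature of the edges: a positive edge asks for equal
  values of \<open>x\<close> at its ends, a negative one for different values.\<close>

definition agreeing :: "('e \<Rightarrow> 'c set) \<Rightarrow> ('e \<Rightarrow> bool) \<Rightarrow> ('c \<Rightarrow> bool) \<Rightarrow> 'e set \<Rightarrow> 'e set" where
  "agreeing E b x F = {e \<in> F. \<forall>j\<in>E e. \<forall>k\<in>E e. j \<noteq> k \<longrightarrow> (x j = x k) = b e}"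

lemma links_mono: "M \<subseteq> N \<Longrightarrow> (links E M)\<^sup>* \<subseteq> (links E N)\<^sup>*"
  by (rule rtrancl_mono) (auto simp: links_def)

text \<open>Add the edges one at a time. If the ends of the new edge are already joined by agreeing
  edges, nothing has to change. Otherwise flipping \<open>x\<close> on the component of one end,
  taken with respect to the agreeing edges, makes the new edge agree. No agreeing edge leaves
  that component, so none of them is lost.\<close>

lemma switching:
  assumes "finite F" "\<forall>e\<in>F. card (E e) = 2"
  shows "\<exists>x. \<forall>e\<in>F. \<forall>j\<in>E e. \<forall>k\<in>E e. (j, k) \<in> (links E (agreeing E b x F))\<^sup>*"
  using assms
proof (induction rule: finite_induct)
  case empty
  then show ?case
    by simp
next
  case (insert e F)
  then obtain x where x: "\<forall>e\<in>F. \<forall>j\<in>E e. \<forall>k\<in>E e. (j, k) \<in> (links E (agreeing E b x F))\<^sup>*"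
    by auto
  let ?M = "agreeing E b x F"
  obtain p q where pq: "E e = {p, q}" "p \<noteq> q"
    using insert.prems by (metis card_2_iff insertI1)
  have "\<exists>y. ?M \<subseteq> agreeing E b y (insert e F) \<and> (p, q) \<in> (links E (agreeing E b y (insert e F)))\<^sup>*"
  proof (cases "(p, q) \<in> (links E ?M)\<^sup>*")
    case True
    have "?M \<subseteq> agreeing E b x (insert e F)"
      by (auto simp: agreeing_def)
    then show ?thesis
      using True links_mono by blast
  next
    case False
    let ?K = "{c. (p, c) \<in> (links E ?M)\<^sup>*}"
    define y where "y c = (if c \<in> ?K \<and> (x p = x q) \<noteq> b e then \<not> x c else x c)" for c
    have "e' \<in> agreeing E b y (insert e F)" if e': "e' \<in> ?M" for e'
    proof -
      obtain c d where cd: "E e' = {c, d}" "c \<noteq> d"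
        using e' insert.prems unfolding agreeing_def by (metis (lifting) card_2_iff insertI2 mem_Collect_eq)
      then have "(c, d) \<in> links E ?M" "(d, c) \<in> links E ?M"
        using e' by (auto simp: links_def)
      then have "c \<in> ?K \<longleftrightarrow> d \<in> ?K"
        by (metis mem_Collect_eq rtrancl.rtrancl_into_rtrancl)
      then have "y c = y d \<longleftrightarrow> x c = x d"
        by (auto simp: y_def)
      then show ?thesis
        using e' cd by (auto simp: agreeing_def)
    qed
    moreover have "e \<in> agreeing E b y (insert e F)"
      using False pq by (auto simp: agreeing_def y_def)
    then have "(p, q) \<in> links E (agreeing E b y (insert e F))"
      using pq by (auto simp: links_def)
    ultimately show ?thesis
      by blast
  qed
  then obtain y where y: "?M \<subseteq> agreeing E b y (insert e F)"
      "(p, q) \<in> (links E (agreeing E b y (insert e F)))\<^sup>*"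
    by blast
  have "(q, p) \<in> (links E (agreeing E b y (insert e F)))\<^sup>*"
    using y(2) sym_rtrancl[OF sym_links] by (metis symE)
  then have "(j, k) \<in> (links E (agreeing E b y (insert e F)))\<^sup>*" if "j \<in> E e" "k \<in> E e" for j k
    using that y(2) pq by auto
  moreover have "(j, k) \<in> (links E (agreeing E b y (insert e F)))\<^sup>*"
    if "e' \<in> F" "j \<in> E e'" "k \<in> E e'" for e' j k
    using that x links_mono[OF y(1), of E] by blast
  ultimately show ?case
    by (intro exI[of _ y]) (metis insertE)
qed

section \<open>Edges and columns of a 3-row graph\<close>

lemma column_eq_image: "column v j = (\<lambda>i. v i j) ` {1..3}"
proof -
  have "{1..3 :: nat} = {1, 2, 3}"
    by auto
  then show ?thesis
    by (simp add: column_def)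
qed

lemma vertex_eq_iff:
  assumes "three_row_graph R v s" "i \<in> {1..3}" "i' \<in> {1..3}" "j \<in> {1..s}" "j' \<in> {1..s}"
  shows "v i j = v i' j' \<longleftrightarrow> i = i' \<and> j = j'"
proof -
  have "inj_on (\<lambda>(i, j). v i j) ({1..3} \<times> {1..s})"
    using assms(1) by (simp add: three_row_graph_def bij_betw_def)
  from inj_onD[OF this, of "(i, j)" "(i', j')"] show ?thesis
    using assms(2-) by auto
qed

lemma in_column_iff:
  assumes "three_row_graph R v s" "i \<in> {1..3}" "j \<in> {1..s}" "j' \<in> {1..s}"
  shows "v i j \<in> column v j' \<longleftrightarrow> j = j'"
  using assms(2) unfolding column_eq_image image_iff
  by (metis vertex_eq_iff[OF assms(1) assms(2) _ assms(3,4)])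

lemma column_graph_ends:
  assumes R: "three_row_graph R v s" and e: "e \<in> edges R"
  obtains i j i' j' where "ends R e = {v i j, v i' j'}" "i \<in> {1..3}" "i' \<in> {1..3}"
    "j \<in> {1..s}" "j' \<in> {1..s}" "j \<noteq> j'" "ends (column_graph R v s) e = {j, j'}"
proof -
  have bij: "bij_betw (\<lambda>(i, j). v i j) ({1..3} \<times> {1..s}) (verts R)"
    and ends: "ends R e \<subseteq> verts R" "card (ends R e) = 2"
    and ind: "\<forall>j\<in>{1..s}. independent_set R (column v j)"
    using R e by (auto simp: three_row_graph_def loopless_multigraph_def)
  obtain x y where xy: "ends R e = {x, y}"
    using ends(2) by (auto simp: card_2_iff)
  then have "x \<in> (\<lambda>(i, j). v i j) ` ({1..3} \<times> {1..s})" "y \<in> (\<lambda>(i, j). v i j) ` ({1..3} \<times> {1..s})"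
    using ends(1) bij by (auto simp: bij_betw_def)
  then obtain i j i' j' where ij: "x = v i j" "y = v i' j'" "i \<in> {1..3}" "i' \<in> {1..3}"
    "j \<in> {1..s}" "j' \<in> {1..s}"
    by auto
  note col = in_column_iff[OF R]
  have "j \<noteq> j'"
    using ind e ij xy col by (fastforce simp: independent_set_def)
  moreover have "ends (column_graph R v s) e = {j, j'}"
    using xy ij col by (auto simp: column_graph_def)
  ultimately show ?thesis
    using that xy ij by blast
qed

text \<open>An edge has at most one end in a column, as columns are independent. So the sum counts
  no edge twice, and the parity condition on a column becomes one on edge sets in the column graph.\<close>

lemma column_color_degree:
  assumes R: "three_row_graph R v s" and j: "j \<in> {1..s}"
  shows "color_degree R g c (v 1 j) + color_degree R g c (v 2 j) + color_degree R g c (v 3 j)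
    = card {e \<in> edges R. j \<in> ends (column_graph R v s) e \<and> g e = c}"
proof -
  have fin: "finite (edges R)" and ind: "independent_set R (column v j)"
    and two: "\<And>e. e \<in> edges R \<Longrightarrow> card (ends R e) = 2"
    using R j by (auto simp: three_row_graph_def loopless_multigraph_def)
  let ?D = "\<lambda>i. {e \<in> incident_edges R (v i j). g e = c}"
  have disj: "?D i \<inter> ?D i' = {}" if "i \<in> {1..3}" "i' \<in> {1..3}" "i \<noteq> i'" for i i'
  proof (rule ccontr)
    assume "?D i \<inter> ?D i' \<noteq> {}"
    then obtain e where e: "e \<in> edges R" "v i j \<in> ends R e" "v i' j \<in> ends R e"
      by (auto simp: incident_edges_def)
    have "v i j \<noteq> v i' j"
      using vertex_eq_iff[OF R that(1,2) j j] that(3) by simp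
    then have "ends R e = {v i j, v i' j}"
      using e two[OF e(1)] by (auto simp: card_2_iff)
    moreover have "{v i j, v i' j} \<subseteq> column v j"
      using that by (auto simp: column_eq_image)
    ultimately show False
      using ind e(1) by (auto simp: independent_set_def)
  qed
  have "{e \<in> edges R. j \<in> ends (column_graph R v s) e \<and> g e = c} = ?D 1 \<union> ?D 2 \<union> ?D 3"
    using j by (auto simp: column_graph_def column_def incident_edges_def)
  moreover have "finite (?D i)" for i
    using fin by (auto simp: incident_edges_def)
  moreover have "(?D 1 \<union> ?D 2) \<inter> ?D 3 = {}" "?D 1 \<inter> ?D 2 = {}"
    using disj[of 1 3] disj[of 2 3] disj[of 1 2] by auto
  ultimately show ?thesis
    by (simp add: color_degree_def card_Un_disjoint)
qed

lemma connected_row_links: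
  assumes R: "three_row_graph R v s" and i: "i \<in> {1..3}"
    and conn: "connected_graph (induced_subgraph R (row v s i))"
    and jk: "j \<in> {1..s}" "k \<in> {1..s}"
  shows "(j, k) \<in> (links (ends (column_graph R v s)) {e \<in> edges R. ends R e \<subseteq> row v s i})\<^sup>*"
proof -
  let ?L = "links (ends (column_graph R v s)) {e \<in> edges R. ends R e \<subseteq> row v s i}"
  have img: "(\<lambda>(i, j). v i j) ` ({1..3} \<times> {1..s}) = verts R"
    using R by (auto simp: three_row_graph_def bij_betw_def)
  have eq: "a = i \<and> c = d"
    if "v a c = v i d" "a \<in> {1..3}" "c \<in> {1..s}" "d \<in> {1..s}" for a c d
    using vertex_eq_iff[OF R that(2) i that(3,4)] that(1) by simp
  have "v i j \<in> verts R" "v i k \<in> verts R"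
    using img i jk by force+
  then have "(v i j, v i k) \<in> (adjacency (induced_subgraph R (row v s i)))\<^sup>*"
    using conn jk by (auto simp: connected_graph_def induced_subgraph_def row_def)
  moreover have "\<forall>m\<in>{1..s}. v i m = y \<longrightarrow> (j, m) \<in> ?L\<^sup>*"
    if "(v i j, y) \<in> (adjacency (induced_subgraph R (row v s i)))\<^sup>*" for y
    using that
  proof (induction rule: rtrancl_induct)
    case base
    then show ?case
      using eq i jk by (metis rtrancl.rtrancl_refl)
  next
    case (step y z)
    obtain e where e: "e \<in> edges R" "ends R e \<subseteq> row v s i" "ends R e = {y, z}"
      using step.hyps by (auto simp: adjacency_def induced_subgraph_def)
    obtain a c a' c' where ac: "ends R e = {v a c, v a' c'}" "a \<in> {1..3}" "a' \<in> {1..3}"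
      "c \<in> {1..s}" "c' \<in> {1..s}" "c \<noteq> c'" "ends (column_graph R v s) e = {c, c'}"
      using column_graph_ends[OF R e(1)] by metis
    have "a = i" "a' = i"
      using e(2) ac eq by (auto simp: row_def)
    have L: "(c, c') \<in> ?L" "(c', c) \<in> ?L"
      using e ac by (auto simp: links_def)
    have "y = v i c \<and> z = v i c' \<or> y = v i c' \<and> z = v i c"
      using e(3) ac(1) \<open>a = i\<close> \<open>a' = i\<close> by (metis doubleton_eq_iff)
    then obtain d d' where d: "y = v i d" "z = v i d'" "d \<in> {1..s}" "d' \<in> {1..s}" "(d, d') \<in> ?L"
      using L ac(4,5) by blast
    show ?case
    proof (intro ballI impI)
      fix m
      assume "m \<in> {1..s}" "v i m = z"
      then have "m = d'"
        using eq[of i m d'] i d by simp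
      moreover have "(j, d) \<in> ?L\<^sup>*"
        using step.IH d by blast
      ultimately show "(j, m) \<in> ?L\<^sup>*"
        using d(5) by (auto intro: rtrancl_into_rtrancl)
    qed
  qed
  ultimately show ?thesis
    using jk by blast
qed

section \<open>The coloring\<close>

theorem corollary20:
  fixes R :: "('v, 'e) multigraph" and v :: "nat \<Rightarrow> nat \<Rightarrow> 'v" and s :: nat
  assumes "three_row_graph R v s"
    and "eulerian (column_graph R v s)"
    and "\<exists>i\<in>{1, 2, 3}. connected_graph (induced_subgraph R (row v s i))"
  shows "\<exists>f g. amiable_coloring R v s f g"
proof -
  let ?E = "ends (column_graph R v s)"
  obtain i0 where i0: "i0 \<in> {1, 2, 3}" and conn: "connected_graph (induced_subgraph R (row v s i0))"
    using assms(3) by blast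
  have i0': "i0 \<in> {1..3}"
    using i0 by auto
  have fin: "finite (edges R)" and inj: "inj_on (\<lambda>(i, j). v i j) ({1..3} \<times> {1..s})"
    using assms(1) by (auto simp: three_row_graph_def loopless_multigraph_def bij_betw_def)
  define pos where "pos = inv_into ({1..3} \<times> {1..s}) (\<lambda>(i, j). v i j)"
  have pos [simp]: "pos (v i j) = (i, j)" if "i \<in> {1..3}" "j \<in> {1..s}" for i j
    using inv_into_f_f[OF inj, of "(i, j)"] that by (simp add: pos_def)
  have two: "card (?E e) = 2" if "e \<in> edges R" for e
    using column_graph_ends[OF assms(1) that] by (metis card_2_iff)
  have Es: "?E e \<subseteq> {1..s}" for e
    by (auto simp: column_graph_def)
  define H where "H = {e \<in> edges R. \<forall>w\<in>ends R e. fst (pos w) \<noteq> i0}"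
  define L where "L = {e \<in> edges R. ends R e \<subseteq> row v s i0}"
  \<comment> \<open>For the ends of an edge of \<open>H\<close> to agree in color, their columns must use the same
    order of the colors 2 and 3 if the ends lie in one row, and opposite orders if not.\<close>
  define b where "b e \<longleftrightarrow> is_singleton (fst ` pos ` ends R e)" for e
  have sub: "H \<subseteq> edges R" "L \<subseteq> edges R"
    by (auto simp: H_def L_def)
  have finHL: "finite H" "finite L"
    using fin sub finite_subset by blast+
  have twoH: "\<forall>e\<in>H. card (?E e) = 2" and twoL: "\<forall>e\<in>L. card (?E e) = 2"
    using two sub by auto
  obtain x where x: "\<forall>e\<in>H. \<forall>j\<in>?E e. \<forall>k\<in>?E e. (j, k) \<in> (links ?E (agreeing ?E b x H))\<^sup>*"
    using switching[OF finHL(1) twoH] by blast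
  have agr: "agreeing ?E b x H \<subseteq> H"
    by (auto simp: agreeing_def)
  then obtain A where A: "A \<subseteq> agreeing ?E b x H" "\<forall>c. odd_at ?E A c = odd_at ?E H c"
    using parity_join[OF finHL(1) finite_subset[OF agr finHL(1)] _ twoH x] twoH by blast
  have AH: "A \<subseteq> H"
    using A by (auto simp: agreeing_def)
  \<comment> \<open>One of the two other rows serves as the reference for the order of the colors 2 and 3:
    \<open>x j\<close> says that its vertex in column \<open>j\<close> has color 2.\<close>
  define p where "p = (if i0 = 1 then 2 else 1 :: nat)"
  define f where "f w = (if fst (pos w) = i0 then 1
      else if (fst (pos w) = p) = x (snd (pos w)) then 2 else 3 :: nat)" for w
  \<comment> \<open>The edges outside the connected row that get color 2.\<close>
  define B where "B = {e \<in> edges R - L. e \<notin> H - A \<and> 2 \<notin> f ` ends R e}"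
  have Bsub: "B \<subseteq> edges R"
    by (auto simp: B_def)
  then have "finite B" "\<forall>e\<in>B. card (?E e) = 2"
    using fin two finite_subset by auto
  moreover have "\<forall>e\<in>B. \<forall>j\<in>?E e. \<forall>k\<in>?E e. (j, k) \<in> (links ?E L)\<^sup>*"
    using connected_row_links[OF assms(1) i0' conn] Es unfolding L_def by blast
  ultimately obtain J where J: "J \<subseteq> L" "\<forall>c. odd_at ?E J c = odd_at ?E B c"
    using parity_join[of B L ?E] finHL(2) twoL by blast
  \<comment> \<open>In the last two cases the ends use the color 1 and one of 2 and 3, or they agree in 2 or 3;
    either way the remaining one of 2 and 3 is admissible.\<close>
  define g where "g e = (if e \<in> L then if e \<in> J then 2 else 3
      else if e \<in> H - A then 1 else if 2 \<in> f ` ends R e then 3 else 2 :: nat)" for e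
  have row_pos: "fst (pos w) = i0" if "w \<in> row v s i0" for w
    using that i0' by (auto simp: row_def)
  have LH: "e \<notin> H" if "e \<in> L" for e
  proof -
    have "card (ends R e) = 2"
      using assms(1) that sub(2) by (auto simp: three_row_graph_def loopless_multigraph_def)
    then have "ends R e \<noteq> {}"
      by auto
    then show ?thesis
      using that row_pos by (auto simp: L_def H_def)
  qed
  have proper: "f w \<noteq> g e" if e: "e \<in> edges R" and w: "w \<in> ends R e" for e w
  proof -
    obtain i j i' j' where ij: "ends R e = {v i j, v i' j'}" "i \<in> {1..3}" "i' \<in> {1..3}"
      "j \<in> {1..s}" "j' \<in> {1..s}" "j \<noteq> j'" "?E e = {j, j'}"
      using column_graph_ends[OF assms(1) e] by metis
    have inL: "e \<in> L \<longleftrightarrow> i = i0 \<and> i' = i0"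
    proof
      assume "e \<in> L"
      then have "fst (pos (v i j)) = i0" "fst (pos (v i' j')) = i0"
        using ij(1) row_pos by (auto simp: L_def)
      then show "i = i0 \<and> i' = i0"
        using ij by simp
    qed (use e ij in \<open>auto simp: L_def row_def\<close>)
    have inH: "e \<in> H \<longleftrightarrow> i \<noteq> i0 \<and> i' \<noteq> i0"
      using e ij by (auto simp: H_def)
    have inA: "f (v i j) = f (v i' j')" if "e \<in> A"
    proof -
      have "(x j = x j') = b e"
        using A(1) that ij by (auto simp: agreeing_def)
      moreover have "b e \<longleftrightarrow> i = i'"
        using ij by (auto simp: b_def is_singleton_def)
      moreover have "i \<noteq> i0" "i' \<noteq> i0"
        using that AH inH by auto
      moreover have "i = i' \<longleftrightarrow> (i = p) = (i' = p)"
        using \<open>i \<noteq> i0\<close> \<open>i' \<noteq> i0\<close> ij(2,3) i0 by (auto simp: p_def)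
      ultimately show ?thesis
        using ij by (auto simp: f_def)
    qed
    have f1: "f (v i j) = 1 \<longleftrightarrow> i = i0" "f (v i' j') = 1 \<longleftrightarrow> i' = i0"
      using ij by (auto simp: f_def)
    have frange: "f u \<in> {1, 2, 3}" for u
      by (simp add: f_def)
    have has2: "2 \<in> f ` ends R e \<longleftrightarrow> f (v i j) = 2 \<or> f (v i' j') = 2"
      using ij(1) by auto
    have "f w = f (v i j) \<or> f w = f (v i' j')"
      using w ij by auto
    moreover consider "e \<in> L" | "e \<notin> L" "e \<in> H - A" | "e \<in> A" | "e \<notin> L" "e \<notin> H"
      by blast
    then have "g e \<noteq> f (v i j) \<and> g e \<noteq> f (v i' j')"
    proof cases
      case 1
      then show ?thesis
        using inL f1 by (simp add: g_def)
    next
      case 2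
      then show ?thesis
        using inH f1 by (simp add: g_def)
    next
      case 3
      then have "e \<notin> L" "f (v i j) \<noteq> 1"
        using AH LH inH f1 by auto
      then show ?thesis
        using 3 inA frange[of "v i j"] by (auto simp: g_def has2)
    next
      case 4
      then have "(f (v i j) = 1) \<noteq> (f (v i' j') = 1)"
        using inH inL f1 by auto
      then show ?thesis
        using 4 frange[of "v i j"] frange[of "v i' j'"] by (auto simp: g_def has2)
    qed
    ultimately show ?thesis
      by metis
  qed
  have D: "even (card {e \<in> edges R. j \<in> ?E e \<and> g e = c})" if "c \<in> {1, 2, 3}" "j \<in> {1..s}" for c j
  proof -
    let ?D = "\<lambda>c. {e \<in> edges R. j \<in> ?E e \<and> g e = c}"
    have "{e \<in> edges R. g e = 1} = sym_diff H A"
      using AH sub LH by (auto simp: g_def)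
    then have "\<not> odd_at ?E {e \<in> edges R. g e = 1} j"
      using A(2) odd_at_sym_diff[OF finHL(1) finite_subset[OF AH finHL(1)], of ?E j] by metis
    moreover have "{e \<in> edges R. g e = 2} = sym_diff J B"
      using J(1) sub by (auto simp: g_def B_def)
    then have "\<not> odd_at ?E {e \<in> edges R. g e = 2} j"
      using J(2) odd_at_sym_diff[OF finite_subset[OF J(1) finHL(2)] finite_subset[OF Bsub fin], of ?E j]
      by metis
    ultimately have even12: "even (card (?D 1))" "even (card (?D 2))"
      by (simp_all add: odd_at_def conj_commute conj_left_commute)
    have "even (degree (column_graph R v s) j)"
      using assms(2) that(2) by (simp add: eulerian_def column_graph_def)
    moreover have "incident_edges (column_graph R v s) j = ?D 1 \<union> ?D 2 \<union> ?D 3"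
      by (auto simp: incident_edges_def column_graph_def g_def)
    moreover have "card (?D 1 \<union> ?D 2 \<union> ?D 3) = card (?D 1) + card (?D 2) + card (?D 3)"
      using fin by (subst card_Un_disjoint; (subst card_Un_disjoint)?) auto
    ultimately have "even (card (?D 3))"
      using even12 by (simp add: degree_def)
    then show ?thesis
      using even12 that by auto
  qed
  have cols: "f y \<noteq> f z" if yz: "j \<in> {1..s}" "y \<in> column v j" "z \<in> column v j" "y \<noteq> z" for j y z
  proof -
    obtain i k where ik: "y = v i j" "z = v k j" "i \<in> {1..3}" "k \<in> {1..3}"
      using yz(2,3) unfolding column_eq_image by blast
    then have "i \<noteq> k"
      using yz(4) by auto
    then show ?thesis
      using ik yz(1) i0 by (auto simp: f_def p_def)
  qed
  have "f w \<in> {1, 2, 3}" "g e \<in> {1, 2, 3}" for w e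
    by (auto simp: f_def g_def)
  moreover have "\<forall>w\<in>verts R. \<forall>e\<in>incident_edges R w. f w \<noteq> g e"
    using proper by (simp add: incident_edges_def)
  moreover have "\<forall>j\<in>{1..s}. \<forall>y\<in>column v j. \<forall>z\<in>column v j. y \<noteq> z \<longrightarrow> f y \<noteq> f z"
    using cols by blast
  moreover have "\<forall>c\<in>{1, 2, 3}. \<forall>j\<in>{1..s}.
      even (color_degree R g c (v 1 j) + color_degree R g c (v 2 j) + color_degree R g c (v 3 j))"
  proof (intro ballI)
    fix c j :: nat
    assume "c \<in> {1, 2, 3}" and j: "j \<in> {1..s}"
    then show "even (color_degree R g c (v 1 j) + color_degree R g c (v 2 j) + color_degree R g c (v 3 j))"
      unfolding column_color_degree[OF assms(1) j] by (rule D)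
  qed
  ultimately have "amiable_coloring R v s f g"
    unfolding amiable_coloring_def by blast
  then show ?thesis
    by blast
qed

end
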